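(* Let $b_1,b_2\ge 2$, $s_1,s_2\ge 1$ and $r_1,r_2$ be integers with $\gcd(r_1,s_1)=\gcd(r_2,s_2)=1$, and consider the maps $f(x)=\frac{1}{b_1}x+\frac{r_1}{s_1}$ and $g(x)=\frac{1}{b_2}x+\frac{r_2}{s_2}$ on $\mathbb{R}$. Assume \[ \frac{b_1r_1}{(b_1-1)s_1}\neq \frac{b_2r_2}{(b_2-1)s_2}. \] Let $C\subseteq\mathbb{R}$ be the attractor of the iterated function system $\{f,g\}$, let $m\ge 2$ be an integer and $K=C^m\subseteq\mathbb{R}^m$. Then there exist uncountably many Liouville vectors $\boldsymbol{\xi}\in K$ that are Dirichlet improvable but not singular. In particular $\mathbf{FS}_m\cap K\neq\emptyset$.
   Context: The attractor $C$ of $\{f,g\}$ is the unique nonempty compact set with $C=f(C)\cup g(C)$. For $\boldsymbol{\xi}\in\mathbb{R}^m$, $\Vert\boldsymbol{\xi}\Vert$ denotes the distance (in maximum norm) from $\boldsymbol{\xi}$ to the nearest integer vector. A vector $\boldsymbol{\xi}\in\mathbb{R}^m$ is Dirichlet improvable if there is $c\in(0,1)$ such that for all sufficiently large $Q$ the system $1\le q\le Q$, $\Vert q\boldsymbol{\xi}\Vert<cQ^{-1/m}$ has an integer solution $q$; it is singular if for every $c>0$ this system has an integer solution for all $Q\ge Q_0(c)$; it is badly approximable if there is $c^\ast>0$ with $\Vert q\boldsymbol{\xi}\Vert>c^\ast q^{-1/m}$ for all integers $q\ge1$. $Di_m,Sing_m,Bad_m$ denote these three sets and $\mathbf{FS}_m=Di_m\setminus(Sing_m\cup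 Bad_m)$. A vector $\boldsymbol{\xi}\in\mathbb{R}^m\setminus\mathbb{Q}^m$ is a Liouville vector if for arbitrarily large $t>0$ there is an integer $q\ge1$ with $\Vert q\boldsymbol{\xi}\Vert\le q^{-t}$. *)

theory Defs
  imports "HOL-Analysis.Analysis"
begin

definition attractor :: "('a::topological_space \<Rightarrow> 'a) \<Rightarrow> ('a \<Rightarrow> 'a) \<Rightarrow> 'a set" where
  "attractor f g = (THE C. C \<noteq> {} \<and> compact C \<and> C = f ` C \<union> g ` C)"

definition int_vectors :: "(real ^ 'm) set" where
  "int_vectors = {p. \<forall>i. p $ i \<in> \<int>}"

definition rat_vectors :: "(real ^ 'm) set" where
  "rat_vectors = {p. \<forall>i. p $ i \<in> \<rat>}"

definition dist_int :: "real ^ 'm \<Rightarrow> real" where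
  "dist_int \<xi> = (INF p\<in>int_vectors. infnorm (\<xi> - p))"

text \<open>The dimension \<open>m\<close> is \<open>CARD('m)\<close>, and \<open>Q\<close> ranges over the real numbers.\<close>

definition dirichlet_solvable :: "real ^ 'm \<Rightarrow> real \<Rightarrow> real \<Rightarrow> bool" where
  "dirichlet_solvable \<xi> c Q \<longleftrightarrow>
     (\<exists>q::nat. 1 \<le> q \<and> real q \<le> Q \<and>
        dist_int (real q *\<^sub>R \<xi>) < c * Q powr (- 1 / real CARD('m)))"

definition Di :: "(real ^ 'm) set" where
  "Di = {\<xi>. \<exists>c. 0 < c \<and> c < 1 \<and> (\<forall>\<^sub>F Q in at_top. dirichlet_solvable \<xi> c Q)}"

definition Sing :: "(real ^ 'm) set" where
  "Sing = {\<xi>. \<forall>c>0. \<forall>\<^sub>F Q in at_top. dirichlet_solvable \<xi> c Q}"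

definition Bad :: "(real ^ 'm) set" where
  "Bad = {\<xi>. \<exists>c>0. \<forall>q::nat. 1 \<le> q \<longrightarrow>
            dist_int (real q *\<^sub>R \<xi>) > c * real q powr (- 1 / real CARD('m))}"

definition FS :: "(real ^ 'm) set" where
  "FS = Di - (Sing \<union> Bad)"

text \<open>
  The denominator must satisfy \<open>q \<ge> 2\<close>: since \<open>dist_int \<xi> \<le> 1/2\<close>, the choice \<open>q = 1\<close>
  would satisfy the inequality for every \<open>\<xi>\<close> and every \<open>t\<close>.
\<close>

definition liouville_vector :: "real ^ 'm \<Rightarrow> bool" where
  "liouville_vector \<xi> \<longleftrightarrow> \<xi> \<notin> rat_vectors \<and>
     (\<forall>T>0. \<exists>t>T. \<exists>q::nat. 2 \<le> q \<and> dist_int (real q *\<^sub>R \<xi>) \<le> real q powr (- t))"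

text \<open>The definite description in \<^const>\<open>attractor\<close> is well-defined for contractions.\<close>

lemma attractor_subset:
  fixes f g :: "'a::heine_borel \<Rightarrow> 'a"
  assumes k: "0 \<le> k" "k < 1"
    and f: "\<And>x y. dist (f x) (f y) \<le> k * dist x y"
    and g: "\<And>x y. dist (g x) (g y) \<le> k * dist x y"
    and C: "C \<noteq> {}" "compact C" "C = f ` C \<union> g ` C"
    and D: "D \<noteq> {}" "compact D" "D = f ` D \<union> g ` D"
  shows "C \<subseteq> D"
proof -
  have step: "infdist (h y) D \<le> k * infdist y D"
    if h: "h = f \<or> h = g" for h y
  proof -
    obtain d where d: "d \<in> D" "infdist y D = dist y d"
      using infdist_attains_inf[OF compact_imp_closed[OF D(2)] D(1)] by blast
    have "h d \<in> f ` D \<union> g ` D" using d(1) h by blast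
    then have "h d \<in> D" using D(3) by simp
    then have "infdist (h y) D \<le> dist (h y) (h d)" by (rule infdist_le)
    also have "\<dots> \<le> k * dist y d" using h f g by blast
    finally show ?thesis using d by simp
  qed
  have "continuous_on C (\<lambda>x. infdist x D)" by (intro continuous_intros)
  then obtain x where x: "x \<in> C" "\<And>y. y \<in> C \<Longrightarrow> infdist y D \<le> infdist x D"
    using continuous_attains_sup[OF C(2,1)] by blast
  obtain h y where y: "y \<in> C" "x = h y" "h = f \<or> h = g"
  proof -
    have "x \<in> f ` C \<union> g ` C" using x(1) C(3) by simp
    then show ?thesis using that by blast
  qed
  have "infdist x D \<le> k * infdist y D" using step y by blast
  also have "\<dots> \<le> k * infdist x D" using x(2) y(1) k by (intro mult_left_mono)
  finally have "(1 - k) * infdist x D \<le> 0" by (simp add: algebra_simps)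
  then have "infdist x D \<le> 0" using k by (simp add: mult_le_0_iff)
  then have "infdist c D = 0" if "c \<in> C" for c
    using x(2)[OF that] infdist_nonneg[of c D] by linarith
  then show ?thesis
    using in_closed_iff_infdist_zero[OF compact_imp_closed[OF D(2)] D(1)] by blast
qed

lemma attractor_exists:
  fixes f g :: "'a::heine_borel \<Rightarrow> 'a"
  assumes k: "0 \<le> k" "k < 1"
    and f: "\<And>x y. dist (f x) (f y) \<le> k * dist x y"
    and g: "\<And>x y. dist (g x) (g y) \<le> k * dist x y"
  shows "\<exists>C. C \<noteq> {} \<and> compact C \<and> C = f ` C \<union> g ` C"
proof -
  define F where "F A = f ` A \<union> g ` A" for A
  have cont: "continuous_on A f" "continuous_on A g" for A
    using f g k by (auto intro!: lipschitz_on_continuous_on lipschitz_onI)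
  have mono: "F A \<subseteq> F B" if "A \<subseteq> B" for A B using that by (auto simp: F_def)
  define x0 :: 'a where "x0 = undefined"
  define R where "R = max (dist (f x0) x0) (dist (g x0) x0) / (1 - k)"
  define K where "K n = (F ^^ n) (cball x0 R)" for n
  have R0: "0 \<le> R" using k by (auto simp: R_def intro!: divide_nonneg_nonneg simp: le_max_iff_disj)
  have Req: "k * R + max (dist (f x0) x0) (dist (g x0) x0) = R"
    using k by (simp add: R_def field_simps)
  have inv: "dist (h x) x0 \<le> R" if "dist x x0 \<le> R" "h = f \<or> h = g" for h x
  proof -
    have "dist (h x) x0 \<le> dist (h x) (h x0) + dist (h x0) x0" by (rule dist_triangle)
    also have "\<dots> \<le> k * dist x x0 + max (dist (f x0) x0) (dist (g x0) x0)"
      using that f g by (intro add_mono) auto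
    also have "\<dots> \<le> k * R + max (dist (f x0) x0) (dist (g x0) x0)"
      using that k by (simp add: mult_left_mono)
    finally show ?thesis using Req by simp
  qed
  have "F (cball x0 R) \<subseteq> cball x0 R"
    using inv by (auto simp: F_def dist_commute)
  then have dec1: "K (Suc n) \<subseteq> K n" for n
    unfolding K_def by (induction n) (auto dest: mono)
  then have dec: "K n \<subseteq> K m" if "m \<le> n" for m n
    using lift_Suc_antimono_le[of K] that by blast
  have KS: "K (Suc n) = F (K n)" for n by (simp add: K_def)
  have cK: "compact (K n) \<and> K n \<noteq> {}" for n
  proof (induction n)
    case 0 then show ?case using R0 by (simp add: K_def)
  next
    case (Suc n)
    then show ?case
      unfolding KS F_def by (auto intro!: compact_Un compact_continuous_image cont)
  qed
  define C where "C = (\<Inter>n. K n)"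
  have ne: "C \<noteq> {}"
    unfolding C_def using cK dec by (intro compact_nest) auto
  have co: "compact C"
    unfolding C_def using cK by (intro compact_Inter) auto
  have "F C \<subseteq> C"
  proof -
    have "F C \<subseteq> K n" for n
    proof -
      have "F C \<subseteq> F (K n)" by (rule mono) (auto simp: C_def)
      then show ?thesis using KS dec1 by blast
    qed
    then show ?thesis by (auto simp: C_def)
  qed
  moreover have "C \<subseteq> F C"
  proof
    fix x assume x: "x \<in> C"
    have main: "x \<in> h ` C" if all: "\<And>n. x \<in> h ` K n" and h: "h = f \<or> h = g" for h
    proof -
      have cl: "closed (h -` {x})"
        using cont[of UNIV] h by (intro continuous_closed_vimage) (auto simp: continuous_on_eq_continuous_at)
      have "(\<Inter>n. K n \<inter> h -` {x}) \<noteq> {}"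
      proof (rule compact_nest)
        show "compact (K n \<inter> h -` {x})" for n using cK cl by blast
        show "K n \<inter> h -` {x} \<noteq> {}" for n using all[of n] by blast
        show "K n \<inter> h -` {x} \<subseteq> K m \<inter> h -` {x}" if "m \<le> n" for m n
          using dec[OF that] by blast
      qed
      then show ?thesis by (auto simp: C_def)
    qed
    show "x \<in> F C"
    proof (rule ccontr)
      assume "x \<notin> F C"
      then obtain a b where a: "x \<notin> f ` K a" and b: "x \<notin> g ` K b"
        using main[of f] main[of g] by (auto simp: F_def)
      have "x \<in> F (K (max a b))" using x KS by (metis C_def INT_D UNIV_I)
      then show False using a b dec[of a "max a b"] dec[of b "max a b"]
        by (auto simp: F_def)
    qed
  qed
  ultimately have "C = f ` C \<union> g ` C"
    unfolding F_def by (rule subset_antisym[rotated])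
  then show ?thesis using ne co by blast
qed

lemma attractor_well_defined:
  fixes f g :: "'a::heine_borel \<Rightarrow> 'a"
  assumes "0 \<le> k" "k < 1"
    and "\<And>x y. dist (f x) (f y) \<le> k * dist x y"
    and "\<And>x y. dist (g x) (g y) \<le> k * dist x y"
  shows "\<exists>!C. C \<noteq> {} \<and> compact C \<and> C = f ` C \<union> g ` C"
  using attractor_exists[OF assms]
proof (rule ex_ex1I)
  fix C D
  assume C: "C \<noteq> {} \<and> compact C \<and> C = f ` C \<union> g ` C"
    and D: "D \<noteq> {} \<and> compact D \<and> D = f ` D \<union> g ` D"
  note C' = C[THEN conjunct1] C[THEN conjunct2, THEN conjunct1] C[THEN conjunct2, THEN conjunct2]
  note D' = D[THEN conjunct1] D[THEN conjunct2, THEN conjunct1] D[THEN conjunct2, THEN conjunct2]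
  have "C \<subseteq> D" by (rule attractor_subset[OF assms C' D'])
  moreover have "D \<subseteq> C" by (rule attractor_subset[OF assms D' C'])
  ultimately show "C = D" by (rule subset_antisym)
qed

end

theory Submission
  imports Defs
begin

text \<open>
  The compositions \<open>f \<circ> g\<close> and \<open>g \<circ> f\<close> have the same ratio \<open>1/B\<close> with \<open>B = b1 b2\<close>, and they differ
  because the fixed points of \<open>f\<close> and \<open>g\<close> do. So \<open>C\<close> contains all sums \<open>\<Sum>j. d j / B^j\<close>
  whose digits are one of two distinct rationals, in particular every
  \<open>P/N + (M/N) B^k \<theta> i\<close>, where \<open>\<theta> i = (\<Sum>n. B^(-i T n))\<close> for a rapidly growing sequence \<open>T\<close>.
  Take these for \<open>i = 1, \<dots>, m\<close> as coordinates of \<open>\<xi>\<close>. The approximants of \<open>\<theta> 1, \<dots>, \<theta> m\<close> of level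
  \<open>n\<close> have the denominators \<open>B^T, B^(2 T), \<dots>, B^(m T)\<close>, with \<open>T = T n\<close>. A positive integer below
  \<open>B^(m T)\<close> is divisible by \<open>B^(i T)\<close> but not by \<open>B^((i+1) T)\<close> for some \<open>i < m\<close>, so it approximates
  one of the \<open>\<theta> i\<close> no better than \<open>B^(-T)\<close>: \<open>\<xi>\<close> is not singular. The integers
  \<open>N B^(T n - k)\<close> and \<open>N B^(m T n - k)\<close> show that \<open>\<xi>\<close> is Dirichlet improvable once \<open>k\<close> is large, and
  the latter ones show that it is Liouville.
\<close>

section \<open>Lacunary series\<close>

lemma summable_lacunary:
  fixes S :: "nat \<Rightarrow> nat" and B :: nat
  assumes "strict_mono S" "B \<ge> 2"
  shows "summable (\<lambda>n. 1 / real B ^ S n)"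
proof (rule summable_comparison_test')
  show "summable (\<lambda>n. (1 / 2 :: real) ^ n)" by (rule summable_geometric) simp
  show "norm (1 / real B ^ S n) \<le> (1 / 2) ^ n" for n
  proof -
    have "(2::real) ^ n \<le> 2 ^ S n"
      using strict_mono_imp_increasing[OF assms(1), of n] by (intro power_increasing) auto
    also have "\<dots> \<le> real B ^ S n" using assms(2) by (intro power_mono) auto
    finally show ?thesis using assms(2) by (simp add: power_one_over field_simps)
  qed
qed

lemma strict_mono_shift: "strict_mono S \<Longrightarrow> strict_mono (\<lambda>n. S (n + a))" for S :: "nat \<Rightarrow> nat"
  by (simp add: strict_mono_def)

text \<open>Strictly increasing natural exponents grow by at least 1 per step, so a geometric series
  of ratio 1/2 dominates for every B >= 2.\<close>

lemma lacunary_tail_le: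
  fixes S :: "nat \<Rightarrow> nat" and B :: nat
  assumes S: "strict_mono S" and B: "B \<ge> 2"
  shows "(\<Sum>n. 1 / real B ^ S (n + a)) \<le> 2 / real B ^ S a"
proof -
  have le: "1 / real B ^ S (n + a) \<le> 1 / real B ^ S a * (1 / 2) ^ n" for n
  proof -
    have "S a + n \<le> S (n + a)"
      by (induction n) (use S in \<open>auto simp: strict_mono_Suc_iff intro: Suc_leI le_less_trans\<close>)
    then have "real B ^ (S a + n) \<le> real B ^ S (n + a)" using B by (intro power_increasing) auto
    moreover have "real B ^ S a * 2 ^ n \<le> real B ^ (S a + n)"
      using B by (auto simp: power_add intro!: mult_left_mono power_mono)
    ultimately have "real B ^ S a * 2 ^ n \<le> real B ^ S (n + a)" by linarith
    then show ?thesis using B by (simp add: power_one_over field_simps)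
  qed
  have geo: "(\<lambda>n. (1 / 2 :: real) ^ n) sums 2"
    using geometric_sums[of "1/2 :: real"] by simp
  have "(\<Sum>n. 1 / real B ^ S (n + a)) \<le> (\<Sum>n. 1 / real B ^ S a * (1 / 2) ^ n)"
    using le geo
    by (intro suminf_le summable_lacunary strict_mono_shift S B summable_mult sums_summable)
  also have "\<dots> = 2 / real B ^ S a"
    using sums_unique[OF sums_mult[OF geo, of "1 / real B ^ S a"]] by simp
  finally show ?thesis .
qed

lemma lacunary_tail_gt:
  fixes S :: "nat \<Rightarrow> nat" and B :: nat
  assumes "strict_mono S" "B \<ge> 2"
  shows "1 / real B ^ S a < (\<Sum>n. 1 / real B ^ S (n + a))"
  using sum_less_suminf[OF summable_lacunary[OF strict_mono_shift[OF assms(1), of a] assms(2)], of 1]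
    assms(2) by simp

lemma lacunary_split:
  fixes S :: "nat \<Rightarrow> nat" and B :: nat
  assumes "strict_mono S" "B \<ge> 2"
  shows "(\<Sum>n. 1 / real B ^ S n) = (\<Sum>n. 1 / real B ^ S (n + a)) + (\<Sum>n<a. 1 / real B ^ S n)"
  using suminf_split_initial_segment[OF summable_lacunary[OF assms]] by simp

text \<open>Let a be the first index of disagreement. The tail with the larger exponent at a is at
  most 2/B <= 1 times B to minus the smaller exponent, and the other tail strictly exceeds that
  power. Strictness is what settles B = 2.\<close>

lemma lacunary_inject:
  fixes S S' :: "nat \<Rightarrow> nat" and B :: nat
  assumes S: "strict_mono S" "strict_mono S'" and B: "B \<ge> 2"
    and eq: "(\<Sum>n. 1 / real B ^ S n) = (\<Sum>n. 1 / real B ^ S' n)"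
  shows "S = S'"
proof (rule ccontr)
  assume "S \<noteq> S'"
  then obtain a where a: "S a \<noteq> S' a" "\<And>n. n < a \<Longrightarrow> S n = S' n"
    using exists_least_iff[of "\<lambda>n. S n \<noteq> S' n"] by blast
  have less: False
    if "R a < R' a" "strict_mono R" "strict_mono R'"
      "(\<Sum>n. 1 / real B ^ R (n + a)) = (\<Sum>n. 1 / real B ^ R' (n + a))" for R R' :: "nat \<Rightarrow> nat"
  proof -
    have "(\<Sum>n. 1 / real B ^ R' (n + a)) \<le> 2 / real B ^ R' a"
      using that B by (intro lacunary_tail_le)
    also have "\<dots> \<le> 2 / real B ^ Suc (R a)"
      using that B by (intro divide_left_mono power_increasing) auto
    also have "\<dots> \<le> 1 / real B ^ R a" using B by (simp add: field_simps)
    also have "\<dots> < (\<Sum>n. 1 / real B ^ R (n + a))" using that B by (intro lacunary_tail_gt)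
    finally show False using that by simp
  qed
  have "(\<Sum>n. 1 / real B ^ S (n + a)) = (\<Sum>n. 1 / real B ^ S' (n + a))"
    using eq a(2) lacunary_split[OF S(1) B, of a] lacunary_split[OF S(2) B, of a] by simp
  then show False using less[of S S'] less[of S' S] S a(1) by (cases "S a < S' a") auto
qed

text \<open>Multiplying by B^u clears the denominators of the first a terms; only the scaled tail
  remains.\<close>

lemma lacunary_near_int:
  fixes S :: "nat \<Rightarrow> nat" and B :: nat
  assumes S: "strict_mono S" and B: "B \<ge> 2" and u: "\<And>n. n < a \<Longrightarrow> S n \<le> u"
  shows "\<exists>Z::int. \<bar>real B ^ u * (\<Sum>n. 1 / real B ^ S n) - Z\<bar> \<le> 2 * real B ^ u / real B ^ S a"
proof
  let ?Z = "\<Sum>n<a. int B ^ (u - S n)"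
  have "real B ^ u * (1 / real B ^ S n) = real B ^ (u - S n)" if "n < a" for n
    using u[OF that] B by (simp add: power_diff)
  then have "real B ^ u * (\<Sum>n<a. 1 / real B ^ S n) = real_of_int ?Z"
    by (simp add: sum_distrib_left)
  then have "real B ^ u * (\<Sum>n. 1 / real B ^ S n) - real_of_int ?Z =
      real B ^ u * (\<Sum>n. 1 / real B ^ S (n + a))"
    by (simp add: lacunary_split[OF S B, of a] algebra_simps)
  moreover have "0 \<le> (\<Sum>n. 1 / real B ^ S (n + a))"
    using lacunary_tail_gt[OF S B, of a] by (rule less_imp_le[OF le_less_trans[rotated]]) simp
  moreover have "real B ^ u * (\<Sum>n. 1 / real B ^ S (n + a)) \<le> real B ^ u * (2 / real B ^ S a)"
    using lacunary_tail_le[OF S B, of a] by (intro mult_left_mono) auto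
  ultimately show "\<bar>real B ^ u * (\<Sum>n. 1 / real B ^ S n) - ?Z\<bar> \<le> 2 * real B ^ u / real B ^ S a"
    by (simp add: mult.commute)
qed

section \<open>Distance to the integer vectors\<close>

lemma infnorm_vec_le_iff: "infnorm (x :: real ^ 'm) \<le> e \<longleftrightarrow> (\<forall>i. \<bar>x $ i\<bar> \<le> e)"
  by (auto simp: infnorm_Max Basis_vec_def inner_axis)

lemma dist_int_le:
  fixes \<zeta> :: "real ^ 'm"
  assumes "\<And>i. \<exists>z::int. \<bar>\<zeta> $ i - z\<bar> \<le> e"
  shows "dist_int \<zeta> \<le> e"
proof -
  obtain z :: "'m \<Rightarrow> int" where z: "\<And>i. \<bar>\<zeta> $ i - z i\<bar> \<le> e" using assms by metis
  let ?p = "(\<chi> i. real_of_int (z i)) :: real ^ 'm"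
  have "dist_int \<zeta> \<le> infnorm (\<zeta> - ?p)"
    unfolding dist_int_def
    by (intro cINF_lower bdd_belowI[where m = 0]) (auto simp: int_vectors_def infnorm_pos_le)
  also have "\<dots> \<le> e" using z by (simp add: infnorm_vec_le_iff)
  finally show ?thesis .
qed

lemma dist_int_lessD:
  fixes \<zeta> :: "real ^ 'm"
  assumes "dist_int \<zeta> < e"
  shows "\<exists>z::int. \<bar>\<zeta> $ i - z\<bar> < e"
proof -
  have "(0 :: real ^ 'm) \<in> int_vectors" by (simp add: int_vectors_def)
  then obtain p :: "real ^ 'm" where p: "p \<in> int_vectors" "infnorm (\<zeta> - p) < e"
    using assms unfolding dist_int_def
    by (subst (asm) cINF_less_iff) (auto intro!: bdd_belowI[where m = 0] simp: infnorm_pos_le)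
  obtain z where "p $ i = real_of_int z" using p(1) by (auto simp: int_vectors_def elim: Ints_cases)
  moreover have "\<bar>(\<zeta> - p) $ i\<bar> \<le> infnorm (\<zeta> - p)" using infnorm_vec_le_iff by blast
  ultimately show ?thesis using p(2) by (auto intro!: exI[of _ z])
qed

lemma less_mult_powr_iff:
  fixes x c Q :: real and m :: nat
  assumes "0 \<le> x" "0 < c" "0 < Q" "0 < m"
  shows "x < c * Q powr (- 1 / real m) \<longleftrightarrow> x ^ m * Q < c ^ m"
proof -
  have "(Q powr (- 1 / real m)) ^ m = Q powr - 1"
    using assms by (simp add: powr_power)
  then have "(c * Q powr (- 1 / real m)) ^ m = c ^ m / Q"
    using assms by (simp only: power_mult_distrib) (simp add: powr_minus_divide)
  moreover have "x < c * Q powr (- 1 / real m) \<longleftrightarrow> x ^ m < (c * Q powr (- 1 / real m)) ^ m"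
    using assms by (auto intro: power_strict_mono dest: power_less_imp_less_base)
  ultimately show ?thesis using assms by (simp add: pos_less_divide_eq)
qed

text \<open>A common denominator of the coordinates has distance 0 and so solves the system for
  every c and all large Q. Through this, failure of singularity gives the irrationality demanded of
  Liouville vectors.\<close>

lemma rat_vector_Sing:
  fixes \<xi> :: "real ^ 'm"
  assumes "\<xi> \<in> rat_vectors"
  shows "\<xi> \<in> Sing"
proof -
  have "\<exists>a b. 0 < b \<and> \<xi> $ i = real_of_int a / real b" for i
  proof -
    have "\<xi> $ i \<in> \<rat>" using assms by (simp add: rat_vectors_def)
    then obtain a b where "0 < b" "\<xi> $ i = of_int a / of_int b" by (rule Rats_cases')
    then show ?thesis by (intro exI[of _ a] exI[of _ "nat b"]) simp
  qed
  then obtain a and b :: "'m \<Rightarrow> nat" where ab: "\<And>i. 0 < b i" "\<And>i. \<xi> $ i = real_of_int (a i) / real (b i)"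
    by metis
  define q where "q = (\<Prod>i\<in>UNIV. b i)"
  have q: "1 \<le> q" using ab(1) by (simp add: q_def Suc_le_eq prod_pos)
  have "\<exists>z::int. \<bar>(real q *\<^sub>R \<xi>) $ i - z\<bar> \<le> 0" for i
  proof -
    obtain d where "q = b i * d" unfolding q_def by (meson dvdE dvd_prodI finite UNIV_I)
    then have "real q * \<xi> $ i = real_of_int (int d * a i)"
      using ab(1)[of i] by (simp add: ab(2))
    then show ?thesis by (intro exI[of _ "int d * a i"]) simp
  qed
  then have 0: "dist_int (real q *\<^sub>R \<xi>) \<le> 0" by (rule dist_int_le)
  have "dirichlet_solvable \<xi> c Q" if "c > 0" "Q \<ge> real q" for c Q
  proof -
    have "0 < c * Q powr (- 1 / real CARD('m))" using that q by simp
    then show ?thesis unfolding dirichlet_solvable_def using 0 that q by (intro exI[of _ q]) linarith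
  qed
  then show ?thesis unfolding Sing_def by (auto simp: eventually_at_top_linorder)
qed

text \<open>Needed to pass from the constructed vectors to \<open>FS\<close>. Beyond the exponent 1
  >= 1/m, a Liouville exponent leaves a factor q^(-s) with q >= 2, which drops below any c.\<close>

lemma liouville_not_Bad:
  fixes \<xi> :: "real ^ 'm"
  assumes "liouville_vector \<xi>"
  shows "\<xi> \<notin> Bad"
proof
  assume "\<xi> \<in> Bad"
  then obtain c where c: "c > 0"
    "\<And>q::nat. 1 \<le> q \<Longrightarrow> dist_int (real q *\<^sub>R \<xi>) > c * real q powr (- 1 / real CARD('m))"
    by (auto simp: Bad_def)
  obtain s :: nat where s: "1 / c < 2 ^ s" using real_arch_pow[of 2 "1 / c"] by auto
  obtain t q where t: "t > real s + 1" and q: "2 \<le> q" "dist_int (real q *\<^sub>R \<xi>) \<le> real q powr (- t)"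
    using assms unfolding liouville_vector_def by (metis add_nonneg_pos of_nat_0_le_iff zero_less_one)
  have "c * real q powr (- 1) \<le> c * real q powr (- 1 / real CARD('m))"
    using q(1) c(1) by (intro mult_left_mono powr_mono) (auto simp: field_simps Suc_le_eq)
  also have "\<dots> < real q powr (- t)" using c(2)[of q] q by linarith
  also have "\<dots> \<le> real q powr (- real s - 1)" using t q(1) by (intro powr_mono) auto
  also have "\<dots> = real q powr (- real s) * real q powr (- 1)" by (simp only: powr_add[symmetric] diff_conv_add_uminus)
  finally have "c < real q powr (- real s)" using q(1) by (simp add: powr_minus_divide divide_less_cancel divide_divide_eq_left[symmetric]
      del: divide_divide_eq_left)
  also have "\<dots> = 1 / real q ^ s" using q(1) by (simp add: powr_minus powr_realpow divide_inverse)
  also have "\<dots> \<le> 1 / 2 ^ s" using q(1) by (intro divide_left_mono power_mono) auto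
  finally show False using s c(1) by (simp add: field_simps)
qed

section \<open>Points with lacunary coordinates\<close>

text \<open>In the factor \<open>n + 4 * m\<close> the constant part separates consecutive levels
  enough for the uniform estimates, and the unbounded part n yields arbitrarily large Liouville
  exponents.\<close>

locale lacunary =
  fixes B m :: nat and T :: "nat \<Rightarrow> nat"
  assumes B: "B \<ge> 2" and m: "m \<ge> 2" and T0: "T 0 \<ge> 1"
    and T_Suc: "\<And>n. (n + 4 * m) * T n \<le> T (Suc n)"
begin

definition \<theta> :: "nat \<Rightarrow> real" where
  "\<theta> i = (\<Sum>n. 1 / real B ^ (i * T n))"

lemma T_mono: "strict_mono T" and T_pos: "T n \<ge> 1"
proof -
  have step: "T n < T (Suc n)" if "T n \<ge> 1" for n
  proof -
    have "2 * T n \<le> (n + 4 * m) * T n" using m by (intro mult_right_mono) auto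
    then show ?thesis using T_Suc[of n] that by linarith
  qed
  have pos: "T n \<ge> 1" for n
  proof (induction n)
    case (Suc n)
    with step[of n] show ?case by linarith
  qed (rule T0)
  show "T n \<ge> 1" by (rule pos)
  show "strict_mono T" using step pos by (simp add: strict_mono_Suc_iff)
qed

lemma T_Suc4: "4 * m * T n \<le> T (Suc n)"
  using T_Suc[of n] by (simp add: algebra_simps)

lemma T_le: "n \<le> T n"
  using strict_mono_imp_increasing[OF T_mono] .

lemma mult_T_mono: "i \<ge> 1 \<Longrightarrow> strict_mono (\<lambda>n. i * T n)"
  using T_mono by (simp add: strict_mono_def)

text \<open>Levels before n contribute multiples of B and level n itself contributes 1, so the
  truncation has a numerator congruent to 1 modulo B. Its denominator B^(i T n) is thus exact, even
  for composite B.\<close>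

lemma \<theta>_split:
  assumes "i \<ge> 1"
  shows "\<exists>H::int. \<exists>e. real B ^ (i * T n) * \<theta> i = real_of_int (int B * H + 1) + real B ^ (i * T n) * e
     \<and> 0 \<le> e \<and> e \<le> 2 / real B ^ T (Suc n)"
proof -
  define H where "H = (\<Sum>n'<n. int B ^ (i * T n - i * T n' - 1))"
  define e where "e = (\<Sum>j. 1 / real B ^ (i * T (j + Suc n)))"
  have "real B ^ (i * T n) * (\<Sum>n'<n. 1 / real B ^ (i * T n')) = real_of_int (int B * H)"
  proof -
    have "real B ^ (i * T n) * (1 / real B ^ (i * T n')) =
        real B * real B ^ (i * T n - i * T n' - 1)" if "n' < n" for n'
    proof -
      have "i * T n' < i * T n" using mult_T_mono[OF assms] that by (simp add: strict_mono_def)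
      then have "i * T n = i * T n' + Suc (i * T n - i * T n' - 1)" by linarith
      then have "real B ^ (i * T n) = real B ^ (i * T n') * (real B * real B ^ (i * T n - i * T n' - 1))"
        by (metis power_add power_Suc)
      then show ?thesis using B by simp
    qed
    then show ?thesis by (simp add: H_def sum_distrib_left)
  qed
  then have "real B ^ (i * T n) * \<theta> i = real_of_int (int B * H + 1) + real B ^ (i * T n) * e"
    using lacunary_split[OF mult_T_mono[OF assms] B, of "Suc n"] B
    by (simp add: \<theta>_def e_def algebra_simps)
  moreover have "0 \<le> e"
    unfolding e_def using lacunary_tail_gt[OF mult_T_mono[OF assms] B, of "Suc n"]
    by (rule less_imp_le[OF le_less_trans[rotated]]) simp
  moreover have "e \<le> 2 / real B ^ (i * T (Suc n))"
    unfolding e_def using lacunary_tail_le[OF mult_T_mono[OF assms] B, of "Suc n"] .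
  moreover have "2 / real B ^ (i * T (Suc n)) \<le> 2 / real B ^ T (Suc n)"
    using B assms by (intro divide_left_mono power_increasing) auto
  ultimately show ?thesis by (metis order_trans)
qed

text \<open>Write q = B^(j T) q' with j maximal. Then q times the truncation of
  \<open>\<theta> (Suc j)\<close> is q' A / B^T, where A is coprime to B and B^T does not divide q'.
  So it lies at least B^(-T) away from every integer, and the tail costs at most half of
  that.\<close>

lemma \<theta>_badly_approx:
  fixes q :: int
  assumes q: "q \<noteq> 0" "\<bar>q\<bar> < int B ^ (m * T n)"
  shows "\<exists>i<m. \<forall>Z::int. 1 / (2 * real B ^ T n) \<le> \<bar>q * \<theta> (Suc i) - Z\<bar>"
proof -
  let ?T = "T n"
  have "\<not> int B ^ (m * ?T) dvd q" using q zdvd_not_zless[of "\<bar>q\<bar>" "int B ^ (m * ?T)"] by auto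
  then obtain j where j: "j < m" "\<forall>i\<le>j. \<not> \<not> int B ^ (i * ?T) dvd q" "\<not> int B ^ (Suc j * ?T) dvd q"
    using ex_least_nat_less[of "\<lambda>i. \<not> int B ^ (i * ?T) dvd q" m] by auto
  obtain q' where q': "q = int B ^ (j * ?T) * q'" using j(2) by (auto elim: dvdE)
  have nd: "\<not> int B ^ ?T dvd q'" using j(3) B by (simp add: q' power_add)
  obtain H :: int and e where He:
    "real B ^ (Suc j * ?T) * \<theta> (Suc j) = real_of_int (int B * H + 1) + real B ^ (Suc j * ?T) * e"
    "0 \<le> e" "e \<le> 2 / real B ^ T (Suc n)"
    using \<theta>_split[of "Suc j" n] by auto
  define A where "A = int B * H + 1"
  have "coprime (int B) A" unfolding A_def
    using gcd_add_mult[of "int B" H 1] by (simp add: coprime_iff_gcd_eq_1 mult.commute)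
  then have ndA: "\<not> int B ^ ?T dvd q' * A" using nd by (simp add: coprime_dvd_mult_left_iff)
  have qe: "\<bar>q * e\<bar> \<le> 1 / (2 * real B ^ ?T)"
  proof -
    have "\<bar>q * e\<bar> \<le> real B ^ (m * ?T) * (2 / real B ^ T (Suc n))"
    proof -
      have "real_of_int \<bar>q\<bar> \<le> real_of_int (int B ^ (m * ?T))" using q(2) by linarith
      then show ?thesis unfolding abs_mult using He(2,3) by (intro mult_mono) auto
    qed
    \<comment> \<open>The spare exponent 2 yields B^(-2) <= 1/4, which reduces the constant 2 of the
      tail bound to 1/2.\<close>
    also have "\<dots> \<le> real B ^ (m * ?T) * (2 / real B ^ (m * ?T + ?T + 2))"
    proof -
      have "m * ?T + ?T + 2 \<le> 4 * m * ?T"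
      proof -
        have "2 * ?T \<le> m * ?T" using m by (intro mult_right_mono) auto
        then show ?thesis using T_pos[of n] by linarith
      qed
      then have "m * ?T + ?T + 2 \<le> T (Suc n)" using T_Suc4[of n] by linarith
      then show ?thesis using B by (intro mult_left_mono divide_left_mono power_increasing) auto
    qed
    also have "\<dots> = 2 / (real B ^ 2 * real B ^ ?T)"
      using B by (simp add: power_add power2_eq_square)
    also have "\<dots> \<le> 2 / (2 ^ 2 * real B ^ ?T)"
      using B by (intro divide_left_mono mult_right_mono power_mono) auto
    finally show ?thesis by simp
  qed
  have "1 / (2 * real B ^ ?T) \<le> \<bar>q * \<theta> (Suc j) - Z\<bar>" for Z :: int
  proof -
    have "q' * A - Z * int B ^ ?T \<noteq> 0" using ndA by (metis dvd_triv_right eq_iff_diff_eq_0)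
    then have "1 \<le> \<bar>q' * A - Z * int B ^ ?T\<bar>" by linarith
    then have 1: "1 \<le> \<bar>real_of_int q' * real_of_int A - real_of_int Z * real B ^ ?T\<bar>"
      by (metis (no_types, lifting) of_int_1_le_iff of_int_abs of_int_diff of_int_mult of_int_of_nat_eq of_int_power)
    have "\<theta> (Suc j) = A / real B ^ (Suc j * ?T) + e"
      using He(1) B unfolding A_def[symmetric] by (simp add: field_simps)
    then have "q * \<theta> (Suc j) - Z =
        (real_of_int q' * real_of_int A - Z * real B ^ ?T) / real B ^ ?T + q * e"
      using B by (simp add: q' power_add field_simps)
    moreover have "1 / real B ^ ?T \<le> \<bar>(real_of_int q' * real_of_int A - Z * real B ^ ?T) / real B ^ ?T\<bar>"
      using 1 by (simp add: abs_divide divide_right_mono)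
    ultimately have "1 / real B ^ ?T - 1 / (2 * real B ^ ?T) \<le> \<bar>q * \<theta> (Suc j) - Z\<bar>"
      using qe abs_triangle_ineq2[of "(real_of_int q' * real_of_int A - Z * real B ^ ?T) / real B ^ ?T" "- (q * e)"]
      by simp
    then show ?thesis by simp
  qed
  then show ?thesis using j(1) by blast
qed

text \<open>For i = 1 the multiplier clears level n, and the error comes from level n + 1. For i >=
  2 the growth of T ensures only that the levels below n are cleared, and the error has order B^(T n
  - i T n) <= B^(-T n).\<close>

lemma \<theta>_near_int_single:
  assumes "1 \<le> i" "i \<le> m"
  shows "\<exists>Z::int. \<bar>real B ^ T n * \<theta> i - Z\<bar> \<le> 2 / real B ^ T n"
proof (cases "i = 1")
  case True
  obtain Z :: int where "\<bar>real B ^ T n * \<theta> i - Z\<bar> \<le> 2 * real B ^ T n / real B ^ T (Suc n)"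
    using lacunary_near_int[OF T_mono B, of "Suc n" "T n"] strict_mono_less_eq[OF T_mono] True
    by (auto simp: \<theta>_def)
  moreover have "2 * real B ^ T n / real B ^ T (Suc n) \<le> 2 * real B ^ T n / real B ^ (T n + T n)"
  proof -
    have "2 * T n \<le> 4 * m * T n" using m by (intro mult_right_mono) auto
    then have "T n + T n \<le> T (Suc n)" using T_Suc4[of n] by linarith
    then show ?thesis using B by (intro divide_left_mono power_increasing) auto
  qed
  moreover have "2 * real B ^ T n / real B ^ (T n + T n) = 2 / real B ^ T n"
    using B by (simp add: power_add)
  ultimately show ?thesis by (intro exI[of _ Z]) linarith
next
  case False
  have le: "i * T n' \<le> T n" if n': "n' < n" for n'
  proof -
    have "i * T n' \<le> 4 * m * T n'" using assms by (intro mult_right_mono) auto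
    also have "\<dots> \<le> T (Suc n')" by (rule T_Suc4)
    also have "\<dots> \<le> T n" using n' strict_mono_less_eq[OF T_mono] by simp
    finally show ?thesis .
  qed
  obtain Z :: int where "\<bar>real B ^ T n * \<theta> i - Z\<bar> \<le> 2 * real B ^ T n / real B ^ (i * T n)"
    unfolding \<theta>_def using lacunary_near_int[OF mult_T_mono[OF assms(1)] B le] by blast
  moreover have "2 * real B ^ T n / real B ^ (i * T n) \<le> 2 * real B ^ T n / real B ^ (T n + T n)"
  proof -
    have "T n + T n \<le> i * T n" using False assms mult_right_mono[of 2 i "T n"] by linarith
    then show ?thesis using B by (intro divide_left_mono power_increasing) auto
  qed
  moreover have "2 * real B ^ T n / real B ^ (T n + T n) = 2 / real B ^ T n"
    using B by (simp add: power_add)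
  ultimately show ?thesis by (intro exI[of _ Z]) linarith
qed

text \<open>Level n is cleared for all i <= m at once, so the error comes from level n + 1.\<close>

lemma \<theta>_near_int_multiple:
  assumes "1 \<le> i" "i \<le> m"
  shows "\<exists>Z::int. \<bar>real B ^ (m * T n) * \<theta> i - Z\<bar> \<le> 2 / real B ^ (T (Suc n) - m * T n)"
proof -
  have "i * T n' \<le> m * T n" if "n' < Suc n" for n'
    using assms that strict_mono_less_eq[OF T_mono] by (intro mult_mono) auto
  then obtain Z :: int where "\<bar>real B ^ (m * T n) * \<theta> i - Z\<bar> \<le> 2 * real B ^ (m * T n) / real B ^ (i * T (Suc n))"
    unfolding \<theta>_def using lacunary_near_int[OF mult_T_mono[OF assms(1)] B] by blast
  moreover have "2 * real B ^ (m * T n) / real B ^ (i * T (Suc n)) \<le> 2 * real B ^ (m * T n) / real B ^ T (Suc n)"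
    using B assms by (intro divide_left_mono power_increasing) auto
  moreover have "2 * real B ^ (m * T n) / real B ^ T (Suc n) = 2 / real B ^ (T (Suc n) - m * T n)"
  proof -
    have "m * T n \<le> T (Suc n)" using T_Suc4[of n] by linarith
    then show ?thesis using B by (simp add: power_diff)
  qed
  ultimately show ?thesis by (intro exI[of _ Z]) linarith
qed

end
section \<open>Dirichlet improvability of lacunary vectors\<close>

text \<open>\<open>idx\<close> numbers the coordinates, as the index type carries no order. T is an
  explicit argument so that vectors of different sequences can be compared.\<close>

definition lacunary_vec ::
  "nat \<Rightarrow> (nat \<Rightarrow> nat) \<Rightarrow> ('m \<Rightarrow> nat) \<Rightarrow> int \<Rightarrow> int \<Rightarrow> nat \<Rightarrow> nat \<Rightarrow> real ^ 'm" where
  "lacunary_vec B T idx P M N k =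
     (\<chi> i. (real_of_int P + real_of_int M * real B ^ k * (\<Sum>n. 1 / real B ^ (Suc (idx i) * T n))) / real N)"

lemma lacunary_vec_inject:
  assumes T: "strict_mono T" "strict_mono T'" and "B \<ge> 2" "M \<noteq> 0" "N \<noteq> 0"
    and eq: "lacunary_vec B T idx P M N k = lacunary_vec B T' idx P M N k"
  shows "T = T'"
proof -
  fix i
  have "lacunary_vec B T idx P M N k $ i = lacunary_vec B T' idx P M N k $ i" by (simp only: eq)
  then have "(\<Sum>n. 1 / real B ^ (Suc (idx i) * T n)) = (\<Sum>n. 1 / real B ^ (Suc (idx i) * T' n))"
    using assms(3-5) by (simp add: lacunary_vec_def)
  moreover have "strict_mono (\<lambda>n. Suc (idx i) * R n)" if "strict_mono R" for R :: "nat \<Rightarrow> nat"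
    using that by (simp add: strict_mono_def del: mult_Suc)
  ultimately have "(\<lambda>n. Suc (idx i) * T n) = (\<lambda>n. Suc (idx i) * T' n)"
    using T assms(3) by (intro lacunary_inject)
  then have "Suc (idx i) * T n = Suc (idx i) * T' n" for n by (rule fun_cong)
  then have "T n = T' n" for n by (metis mult_cancel1 nat.distinct(1))
  then show ?thesis by (rule ext)
qed

text \<open>The factor B^k in the coordinates lets \<open>N * B ^ (u - k)\<close> play the role of
  B^u, which makes the denominator smaller by B^k. By \<open>k_large\<close> this gain outweighs the
  costs N and |M|; the 4 combines the 2 of the tail bounds with the 2 of the improvement constant
  1/2.\<close>

locale lacunary_point = lacunary +
  fixes idx :: "'m::finite \<Rightarrow> nat" and P M :: int and N k :: nat
  assumes card: "m = CARD('m)" and idx: "bij_betw idx UNIV {..<m}"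
    and M: "M \<noteq> 0" and N: "N \<noteq> 0" and k: "k \<le> T 0"
    and k_large: "(4 * \<bar>real_of_int M\<bar>) ^ m * real N \<le> real B ^ k"
begin

definition \<xi> :: "real ^ 'm" where
  "\<xi> = lacunary_vec B T idx P M N k"

lemma \<xi>_nth: "\<xi> $ i = (P + M * real B ^ k * \<theta> (Suc (idx i))) / N"
  by (simp add: \<xi>_def lacunary_vec_def \<theta>_def)

lemma k_le_T: "k \<le> T n"
  using k strict_mono_less_eq[OF T_mono, of 0 n] by simp

text \<open>N cancels and B^k restores B^u, so the only loss is the factor |M|.\<close>

lemma dist_\<xi>_le:
  fixes e :: real
  assumes u: "k \<le> u" and e: "\<And>i. 1 \<le> i \<Longrightarrow> i \<le> m \<Longrightarrow> \<exists>Z::int. \<bar>real B ^ u * \<theta> i - Z\<bar> \<le> e"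
  shows "dist_int (real (N * B ^ (u - k)) *\<^sub>R \<xi>) \<le> \<bar>M\<bar> * e"
proof (rule dist_int_le)
  fix i
  have "idx i < m" using idx by (auto simp: bij_betw_def)
  then obtain Z :: int where Z: "\<bar>real B ^ u * \<theta> (Suc (idx i)) - Z\<bar> \<le> e"
    using e[of "Suc (idx i)"] by auto
  have "real B ^ u = real B ^ (u - k) * real B ^ k" using u by (simp flip: power_add)
  then have "(real (N * B ^ (u - k)) *\<^sub>R \<xi>) $ i - real_of_int (int B ^ (u - k) * P + M * Z) =
      M * (real B ^ u * \<theta> (Suc (idx i)) - Z)"
    using N by (simp add: \<xi>_nth field_simps)
  then have "\<bar>(real (N * B ^ (u - k)) *\<^sub>R \<xi>) $ i - real_of_int (int B ^ (u - k) * P + M * Z)\<bar> \<le> \<bar>M\<bar> * e"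
    using Z by (simp add: abs_mult mult_left_mono)
  then show "\<exists>z::int. \<bar>(real (N * B ^ (u - k)) *\<^sub>R \<xi>) $ i - z\<bar> \<le> \<bar>M\<bar> * e" by blast
qed

text \<open>The single integer \<open>N * B ^ (u - k)\<close> serves a whole range of Q: from its
  own size until (2 |M| B^(-w))^m Q reaches 2^(-m), which by \<open>k_large\<close> does not happen
  while Q B^k < N B^(m w).\<close>

lemma solvable_between:
  assumes u: "k \<le> u"
    and e: "\<And>i. 1 \<le> i \<Longrightarrow> i \<le> m \<Longrightarrow> \<exists>Z::int. \<bar>real B ^ u * \<theta> i - Z\<bar> \<le> 2 / real B ^ w"
    and Q: "real N * real B ^ (u - k) \<le> Q" "Q * real B ^ k < real N * real B ^ (m * w)"
  shows "dirichlet_solvable \<xi> (1 / 2) Q"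
proof -
  let ?M = "\<bar>real_of_int M\<bar>"
  have "0 < real N * real B ^ (u - k)" using N B by simp
  then have Q0: "0 < Q" using Q(1) by linarith
  have "((4 * ?M) ^ m * Q) * real N \<le> Q * real B ^ k"
    using mult_right_mono[OF k_large, of Q] Q0 by (simp add: ac_simps)
  then have "(4 * ?M) ^ m * Q < real B ^ (m * w)"
    using Q(2) N by (smt (verit) mult.commute mult_less_cancel_left_pos of_nat_0_less_iff neq0_conv)
  then have "(\<bar>M\<bar> * (2 / real B ^ w)) ^ m * Q < (1 / 2) ^ m"
    using B by (simp add: power_mult_distrib power_divide power_mult[symmetric] mult.commute[of w] field_simps
        flip: power_mult_distrib[of 2 2])
  then have "\<bar>M\<bar> * (2 / real B ^ w) < 1 / 2 * Q powr (- 1 / real m)"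
    using Q0 m by (subst less_mult_powr_iff) auto
  then have "dist_int (real (N * B ^ (u - k)) *\<^sub>R \<xi>) < 1 / 2 * Q powr (- 1 / real m)"
    using dist_\<xi>_le[OF u e] by linarith
  then show ?thesis
    unfolding dirichlet_solvable_def card[symmetric] using Q(1) N B by (intro exI[of _ "N * B ^ (u - k)"]) (auto simp: Suc_le_eq)
qed

lemma \<xi>_Di: "\<xi> \<in> Di"
proof -
  have "dirichlet_solvable \<xi> (1 / 2) Q" if Q: "Q \<ge> real N * real B ^ (T 0 - k)" for Q
  proof -
    obtain n0 where n0: "Q < real B ^ n0" using real_arch_pow[of "real B" Q] B by auto
    have "real B ^ n0 \<le> real N * real B ^ (T (n0 + k) - k)"
    proof -
      have "1 * real B ^ n0 \<le> real N * real B ^ (T (n0 + k) - k)"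
        using T_le[of "n0 + k"] N B by (intro mult_mono power_increasing) auto
      then show ?thesis by simp
    qed
    \<comment> \<open>Q is placed between the first denominators of levels n and n + 1. There
      \<open>N * B ^ (T n - k)\<close> works up to exactly the size at which
      \<open>N * B ^ (m * T n - k)\<close> becomes available, and the latter works for the
      rest.\<close>
    then obtain n where n: "real N * real B ^ (T n - k) \<le> Q" "Q < real N * real B ^ (T (Suc n) - k)"
      using ex_least_nat_less[of "\<lambda>n. Q < real N * real B ^ (T n - k)" "n0 + k"] Q n0
      by (auto simp: not_less)
    show ?thesis
    proof (cases "Q * real B ^ k < real N * real B ^ (m * T n)")
      case True
      then show ?thesis using n(1) k_le_T \<theta>_near_int_single by (intro solvable_between[of "T n" "T n"])
    next
      case False
      have kd: "k \<le> m * T n" using k_le_T[of n] m by (simp add: order_trans[OF _ mult_le_mono1[of 1]])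
      have "real B ^ (m * T n) = real B ^ (m * T n - k) * real B ^ k" using kd by (simp flip: power_add)
      then have "(real N * real B ^ (m * T n - k)) * real B ^ k \<le> Q * real B ^ k"
        using False by (simp add: ac_simps)
      then have "real N * real B ^ (m * T n - k) \<le> Q" using B by simp
      moreover have "Q * real B ^ k < real N * real B ^ (m * (T (Suc n) - m * T n))"
      proof -
        have "Q * real B ^ k < real N * real B ^ (T (Suc n) - k) * real B ^ k"
          using n(2) B by simp
        also have "\<dots> = real N * real B ^ T (Suc n)"
          using k_le_T[of "Suc n"] by (simp flip: power_add)
        also have "\<dots> \<le> real N * real B ^ (m * (T (Suc n) - m * T n))"
        proof -
          \<comment> \<open>By the growth of T, \<open>m * T n\<close> is at most a quarter of
            \<open>T (Suc n)\<close>; the factor 2 is then covered by m >= 2.\<close>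
          have "T (Suc n) \<le> 2 * (T (Suc n) - m * T n)" using T_Suc4[of n] by linarith
          also have "\<dots> \<le> m * (T (Suc n) - m * T n)" using m by (intro mult_right_mono) auto
          finally show ?thesis using B by (intro mult_left_mono power_increasing) auto
        qed
        finally show ?thesis .
      qed
      ultimately show ?thesis
        using kd \<theta>_near_int_multiple by (intro solvable_between[of "m * T n" "T (Suc n) - m * T n"])
    qed
  qed
  then have ev: "\<forall>\<^sub>F Q in at_top. dirichlet_solvable \<xi> (1 / 2) Q"
    by (rule eventually_at_top_linorderI)
  show ?thesis
    unfolding Di_def by (intro CollectI exI[of _ "1/2"] conjI ev) simp_all
qed

text \<open>With a = q M B^k, N times a coordinate of q \<xi> is an integer plus a multiple a of
  some \<theta>. The bound on Q keeps |a| below B^(m T n), so \<open>\<theta>_badly_approx\<close>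
  applies. The constant is independent of n, as non-singularity requires.\<close>

lemma \<xi>_not_solvable:
  fixes Y :: real
  defines "Y \<equiv> 2 * \<bar>real_of_int M\<bar> * real B ^ k"
  shows "\<not> dirichlet_solvable \<xi> (1 / (2 * N * Y)) (real B ^ (m * T n) / Y)"
proof
  let ?Q = "real B ^ (m * T n) / Y"
  have "1 * 1 \<le> \<bar>real_of_int M\<bar> * real B ^ k"
    using M B by (intro mult_mono one_le_power) auto
  then have Y: "1 \<le> Y" by (simp add: Y_def)
  have Q0: "0 < ?Q" using Y B by simp
  assume "dirichlet_solvable \<xi> (1 / (2 * N * Y)) ?Q"
  then obtain q where q: "1 \<le> q" "real q \<le> ?Q"
    and dist: "dist_int (real q *\<^sub>R \<xi>) < 1 / (2 * N * Y) * ?Q powr (- 1 / real m)"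
    by (auto simp: dirichlet_solvable_def card[symmetric])
  define a where "a = int q * M * int B ^ k"
  have "a \<noteq> 0" using q(1) M B by (simp add: a_def)
  moreover have "\<bar>a\<bar> < int B ^ (m * T n)"
  proof -
    have "2 * real_of_int \<bar>a\<bar> = real q * Y" by (simp add: a_def Y_def abs_mult)
    also have "\<dots> \<le> real B ^ (m * T n)" using q(2) Y by (simp add: field_simps)
    also have "\<dots> < 2 * real B ^ (m * T n)" using B by simp
    finally have "real_of_int \<bar>a\<bar> < real_of_int (int B ^ (m * T n))" by simp
    then show ?thesis by linarith
  qed
  ultimately obtain i where i: "i < m" "\<And>Z::int. 1 / (2 * real B ^ T n) \<le> \<bar>a * \<theta> (Suc i) - Z\<bar>"
    using \<theta>_badly_approx by blast
  have "i \<in> range idx" using i(1) bij_betw_imp_surj_on[OF idx] by simp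
  then obtain j where j: "idx j = i" by blast
  obtain z :: int where z: "\<bar>(real q *\<^sub>R \<xi>) $ j - z\<bar> < 1 / (2 * N * Y) * ?Q powr (- 1 / real m)"
    using dist_int_lessD[OF dist] by blast
  have "a * \<theta> (Suc i) - real_of_int (int N * z - int q * P) = N * ((real q *\<^sub>R \<xi>) $ j - z)"
    using N by (simp add: \<xi>_nth j a_def field_simps)
  then have "1 / (2 * real B ^ T n) \<le> N * \<bar>(real q *\<^sub>R \<xi>) $ j - z\<bar>"
    using i(2)[of "int N * z - int q * P"] by (simp add: abs_mult)
  then have "1 / (2 * N * real B ^ T n) \<le> \<bar>(real q *\<^sub>R \<xi>) $ j - z\<bar>"
    using N B by (simp add: field_simps)
  then have "1 / (2 * N * real B ^ T n) < 1 / (2 * N * Y) * ?Q powr (- 1 / real m)" using z by linarith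
  then have "(1 / (2 * N * real B ^ T n)) ^ m * ?Q < (1 / (2 * N * Y)) ^ m"
    using Q0 Y N B m by (subst (asm) less_mult_powr_iff) auto
  \<comment> \<open>The m-th power of B^(T n) cancels against Q, so n disappears and 1/Y < (1/Y)^m
    is left, impossible for Y >= 1.\<close>
  moreover have "(1 / (2 * N * real B ^ T n)) ^ m * ?Q = (1 / (2 * N)) ^ m * (1 / Y)"
    using B by (simp add: power_divide power_mult_distrib mult.commute[of m] power_mult)
  moreover have "(1 / (2 * N * Y)) ^ m = (1 / (2 * N)) ^ m * (1 / Y) ^ m"
    by (simp add: power_divide power_mult_distrib)
  ultimately have "(1 / (2 * N)) ^ m * (1 / Y) < (1 / (2 * N)) ^ m * (1 / Y) ^ m"
    by (simp only:)
  then have "1 / Y < (1 / Y) ^ m"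
    by (rule mult_left_less_imp_less) simp
  moreover have "(1 / Y) ^ m \<le> (1 / Y) ^ 1" using Y m by (intro power_decreasing) auto
  ultimately show False by simp
qed

lemma \<xi>_not_Sing: "\<xi> \<notin> Sing"
proof
  assume S: "\<xi> \<in> Sing"
  define Y where "Y = 2 * \<bar>real_of_int M\<bar> * real B ^ k"
  have Y: "0 < Y" using M B by (simp add: Y_def)
  have "\<forall>\<^sub>F Q in at_top. dirichlet_solvable \<xi> (1 / (2 * N * Y)) Q"
    using S Y N by (simp add: Sing_def)
  then obtain X where X: "\<And>Q. Q \<ge> X \<Longrightarrow> dirichlet_solvable \<xi> (1 / (2 * N * Y)) Q"
    by (auto simp: eventually_at_top_linorder)
  obtain n where "X * Y < real B ^ n" using real_arch_pow[of "real B"] B by auto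
  also have "\<dots> \<le> real B ^ (m * T n)"
  proof -
    have "1 * n \<le> m * T n" using m T_le[of n] by (intro mult_mono) auto
    then show ?thesis using B by (intro power_increasing) auto
  qed
  finally have "X \<le> real B ^ (m * T n) / Y" using Y by (simp add: field_simps)
  then show False using X \<xi>_not_solvable unfolding Y_def by blast
qed

lemma \<xi>_liouville: "liouville_vector \<xi>"
  unfolding liouville_vector_def
proof (intro conjI allI impI)
  show "\<xi> \<notin> rat_vectors" using rat_vector_Sing \<xi>_not_Sing by blast
  fix t0 :: real
  obtain s :: nat where s: "t0 < real s" using reals_Archimedean2 by blast
  \<comment> \<open>The first summand makes \<open>T (Suc n)\<close> large enough for the exponent
    s; the other two keep N and 2 |M| below n, hence below B^(T n).\<close>
  define n where "n = (m + 1) * (s + 1) + N + 2 * nat \<bar>M\<bar>"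
  define q where "q = N * B ^ (m * T n - k)"
  have dT: "2 * T n \<le> m * T n" using m by (intro mult_right_mono) auto
  then have "k + 1 \<le> m * T n" using k_le_T[of n] T_pos[of n] by linarith
  then have kd: "k \<le> m * T n" "1 \<le> m * T n - k" by auto
  have "B ^ 1 \<le> B ^ (m * T n - k)" using B kd by (intro power_increasing) auto
  moreover have "1 * B ^ (m * T n - k) \<le> q" unfolding q_def using N by (intro mult_right_mono) auto
  ultimately have q2: "2 \<le> q" using B by simp
  have pow: "real j \<le> real B ^ T n" if "j \<le> n" for j
  proof -
    have "j < 2 ^ j" by (rule less_exp)
    also have "(2::nat) ^ j \<le> 2 ^ T n" using that T_le[of n] by (intro power_increasing) auto
    also have "(2::nat) ^ T n \<le> B ^ T n" using B by (intro power_mono) auto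
    finally show ?thesis by (simp flip: of_nat_power)
  qed
  have "real q ^ s * (2 * \<bar>M\<bar>) \<le> (real B ^ ((m + 1) * T n)) ^ s * real B ^ T n"
  proof -
    have "real q \<le> real B ^ T n * real B ^ (m * T n)"
      unfolding q_def of_nat_mult of_nat_power using B pow[of N]
      by (intro mult_mono power_increasing) (auto simp: n_def)
    moreover have "real (2 * nat \<bar>M\<bar>) \<le> real B ^ T n" by (rule pow) (simp add: n_def)
    ultimately show ?thesis by (intro mult_mono power_mono) (auto simp: power_add)
  qed
  also have "\<dots> = real B ^ ((m + 1) * s * T n + T n)"
    by (simp add: power_add algebra_simps flip: power_mult)
  also have "\<dots> \<le> real B ^ (T (Suc n) - m * T n)"
  proof -
    \<comment> \<open>The product splits as (m + 1) s + 1 + m: the shares of q^s, of 2 |M| and of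
      the multiplier B^(m T n).\<close>
    have "((m + 1) * (s + 1)) * T n \<le> (n + 4 * m) * T n" unfolding n_def by (intro mult_right_mono) auto
    then have "(m + 1) * s * T n + T n + m * T n \<le> T (Suc n)"
      using T_Suc[of n] by (simp add: algebra_simps)
    then have "(m + 1) * s * T n + T n \<le> T (Suc n) - m * T n" by linarith
    then show ?thesis using B by (intro power_increasing) auto
  qed
  finally have "\<bar>M\<bar> * (2 / real B ^ (T (Suc n) - m * T n)) \<le> 1 / real q ^ s"
    using B q2 by (simp add: field_simps)
  moreover have "dist_int (real q *\<^sub>R \<xi>) \<le> \<bar>M\<bar> * (2 / real B ^ (T (Suc n) - m * T n))"
    unfolding q_def using dist_\<xi>_le[OF kd(1) \<theta>_near_int_multiple[of _ n]] by simp
  moreover have "1 / real q ^ s = real q powr (- real s)"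
    using q2 by (simp add: powr_minus powr_realpow divide_inverse)
  ultimately show "\<exists>t>t0. \<exists>q::nat. 2 \<le> q \<and> dist_int (real q *\<^sub>R \<xi>) \<le> real q powr (- t)"
    using s q2 by (intro exI[of _ "real s"] conjI exI[of _ q]) auto
qed

end

section \<open>Points of the attractor\<close>

text \<open>Composing n of the maps c -> x j + c/B gives a point of C with leading digits x 0, ...,
  x (n-1) and remainder c/B^n. The remainder tends to 0, and C is closed.\<close>

lemma digit_sum_in_invariant:
  fixes C :: "real set" and x :: "nat \<Rightarrow> real"
  assumes C: "closed C" "C \<noteq> {}" and B: "B > 1"
    and step: "\<And>n c. c \<in> C \<Longrightarrow> x n + c / B \<in> C" and s: "(\<lambda>j. x j / B ^ j) sums s"
  shows "s \<in> C"
proof -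
  obtain c where c: "c \<in> C" using C(2) by blast
  have "(\<Sum>j<n. x j / B ^ j) + c / B ^ n \<in> C" if "c \<in> C" for n c
    using that
  proof (induction n arbitrary: c)
    case (Suc n)
    from Suc.IH[OF step[OF Suc.prems, of n]] show ?case by (simp add: add_divide_distrib ac_simps)
  qed simp
  moreover have "(\<lambda>n. (\<Sum>j<n. x j / B ^ j) + c / B ^ n) \<longlonglongrightarrow> s + 0"
    using s B LIMSEQ_divide_realpow_zero[of B c] by (intro tendsto_add) (simp_all add: sums_def)
  ultimately have "s + 0 \<in> C" using c C(1) by (meson closed_sequentially)
  then show ?thesis by simp
qed

text \<open>The digit is \<sigma> at the positions S n - k and \<rho> elsewhere. Constant digits
  \<rho> give a geometric series, and each excess \<sigma> - \<rho> enters with weight B^k / B^(S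
  n).\<close>

lemma lacunary_in_invariant:
  fixes C :: "real set" and B k :: nat and \<rho> \<sigma> :: real
  assumes C: "closed C" "C \<noteq> {}" and B: "B \<ge> 2"
    and step: "\<And>c. c \<in> C \<Longrightarrow> \<rho> + c / B \<in> C" "\<And>c. c \<in> C \<Longrightarrow> \<sigma> + c / B \<in> C"
    and S: "strict_mono S" "\<And>n. k \<le> S n"
  shows "\<rho> * B / (real B - 1) + (\<sigma> - \<rho>) * B ^ k * (\<Sum>n. 1 / B ^ S n) \<in> C"
proof (rule digit_sum_in_invariant[OF C, of B])
  let ?A = "range (\<lambda>n. S n - k)"
  let ?x = "\<lambda>j. if j \<in> ?A then \<sigma> else \<rho>"
  have mono: "strict_mono (\<lambda>n. S n - k)"
    using S by (auto simp: strict_mono_def intro: diff_less_mono)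
  show "real B > 1" using B by simp
  show "?x n + c / B \<in> C" if "c \<in> C" for n c using step that by simp
  have "(\<lambda>n. 1 / real B ^ S n) sums (\<Sum>n. 1 / real B ^ S n)"
    using summable_lacunary[OF S(1) B] by (rule summable_sums)
  then have "(\<lambda>n. (\<sigma> - \<rho>) * B ^ k * (1 / real B ^ S n)) sums ((\<sigma> - \<rho>) * B ^ k * (\<Sum>n. 1 / real B ^ S n))"
    by (rule sums_mult)
  moreover have "(\<sigma> - \<rho>) * B ^ k * (1 / real B ^ S n) = (\<sigma> - \<rho>) / real B ^ (S n - k)" for n
    using S(2)[of n] B by (simp add: power_diff)
  ultimately have "(\<lambda>n. if S n - k \<in> ?A then (\<sigma> - \<rho>) / real B ^ (S n - k) else 0) sums
      ((\<sigma> - \<rho>) * B ^ k * (\<Sum>n. 1 / real B ^ S n))" by simp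
  \<comment> \<open>Reindexing turns the sum over n into one over all digit positions, with 0 off
    the chosen ones.\<close>
  then have "(\<lambda>j. if j \<in> ?A then (\<sigma> - \<rho>) / real B ^ j else 0) sums ((\<sigma> - \<rho>) * B ^ k * (\<Sum>n. 1 / B ^ S n))"
    by (subst (asm) sums_mono_reindex[OF mono]) auto
  moreover have "(\<lambda>j. \<rho> * (1 / real B) ^ j) sums (\<rho> * (1 / (1 - 1 / real B)))"
    using B by (intro sums_mult geometric_sums) simp
  ultimately have "(\<lambda>j. \<rho> * (1 / real B) ^ j + (if j \<in> ?A then (\<sigma> - \<rho>) / real B ^ j else 0)) sums
      (\<rho> * (1 / (1 - 1 / real B)) + (\<sigma> - \<rho>) * B ^ k * (\<Sum>n. 1 / B ^ S n))"
    by (intro sums_add)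
  moreover have "\<rho> * (1 / real B) ^ j + (if j \<in> ?A then (\<sigma> - \<rho>) / real B ^ j else 0) = ?x j / real B ^ j" for j
    by (simp add: power_one_over diff_divide_distrib)
  moreover have "\<rho> * (1 / (1 - 1 / real B)) = \<rho> * B / (real B - 1)"
    using B by (simp add: field_simps)
  ultimately show "(\<lambda>j. ?x j / real B ^ j) sums (\<rho> * B / (real B - 1) + (\<sigma> - \<rho>) * B ^ k * (\<Sum>n. 1 / B ^ S n))"
    by simp
qed

section \<open>Uncountably many exponent sequences\<close>

lemma uncountable_nat_sets: "uncountable (UNIV :: nat set set)"
proof
  assume "countable (UNIV :: nat set set)"
  then have "range (from_nat_into (UNIV :: nat set set)) = Pow UNIV" by simp
  then show False using Cantors_theorem by blast
qed

text \<open>The free choice of \<open>X\<close> makes the set of constructed vectors uncountable.\<close>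

primrec lacunary_seq :: "nat \<Rightarrow> nat \<Rightarrow> nat set \<Rightarrow> nat \<Rightarrow> nat" where
  "lacunary_seq m t X 0 = t"
| "lacunary_seq m t X (Suc n) = (n + 4 * m) * lacunary_seq m t X n + of_bool (n \<in> X)"

text \<open>Whether n lies in X can be read off from two consecutive values.\<close>

lemma inj_lacunary_seq: "inj (lacunary_seq m t)"
proof
  fix X X'
  assume eq: "lacunary_seq m t X = lacunary_seq m t X'"
  have "n \<in> X \<longleftrightarrow> n \<in> X'" for n
    using fun_cong[OF eq, of n] fun_cong[OF eq, of "Suc n"] by (simp add: of_bool_eq_iff)
  then show "X = X'" by blast
qed

lemma lacunary_lacunary_seq:
  "B \<ge> 2 \<Longrightarrow> m \<ge> 2 \<Longrightarrow> t \<ge> 1 \<Longrightarrow> lacunary B m (lacunary_seq m t X)"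
  by unfold_locales auto

theorem theorem1:
  fixes b1 b2 s1 s2 r1 r2 :: int
    and f g :: "real \<Rightarrow> real"
    and C :: "real set"
    and K :: "(real ^ 'm) set"
  assumes "b1 \<ge> 2" and "b2 \<ge> 2" and "s1 \<ge> 1" and "s2 \<ge> 1"
    and "gcd r1 s1 = 1" and "gcd r2 s2 = 1"
    and "\<And>x. f x = 1 / real_of_int b1 * x + real_of_int r1 / real_of_int s1"
    and "\<And>x. g x = 1 / real_of_int b2 * x + real_of_int r2 / real_of_int s2"
    and "real_of_int (b1 * r1) / real_of_int ((b1 - 1) * s1)
           \<noteq> real_of_int (b2 * r2) / real_of_int ((b2 - 1) * s2)"
    and "C = attractor f g"
    and "CARD('m) \<ge> 2"
    and "K = {\<xi>. \<forall>i. \<xi> $ i \<in> C}"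
  shows "uncountable {\<xi> \<in> K. liouville_vector \<xi> \<and> \<xi> \<in> Di \<and> \<xi> \<notin> Sing} \<and> FS \<inter> K \<noteq> {}"
proof -
  have contr: "dist (h x) (h y) \<le> 1 / 2 * dist x y"
    if "\<And>x. h x = 1 / real_of_int b * x + c" "b \<ge> 2" for h :: "real \<Rightarrow> real" and b c x y
  proof -
    have "dist (h x) (h y) = 1 / real_of_int b * dist x y"
      using that by (simp add: dist_real_def abs_divide flip: diff_divide_distrib)
    also have "\<dots> \<le> 1 / 2 * dist x y" using that(2) by (intro mult_right_mono divide_left_mono) auto
    finally show ?thesis .
  qed
  \<comment> \<open>Unique existence makes the definite description \<open>attractor f g\<close>
    denote a set with these properties.\<close>
  have "\<exists>!C. C \<noteq> {} \<and> compact C \<and> C = f ` C \<union> g ` C"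
    by (rule attractor_well_defined[of "1/2"]) (use contr[of f b1] contr[of g b2] assms(1,2,7,8) in auto)
  then have C: "C \<noteq> {}" "compact C" "C = f ` C \<union> g ` C"
    unfolding assms(10) attractor_def by (auto dest!: theI')
  have fC: "f c \<in> C" and gC: "g c \<in> C" if "c \<in> C" for c using C(3) that by blast+

  define B where "B = nat (b1 * b2)"
  have "2 * 2 \<le> b1 * b2" using assms(1,2) by (intro mult_mono) auto
  then have B: "B \<ge> 2" "real B = real_of_int b1 * real_of_int b2" by (auto simp: B_def)
  \<comment> \<open>\<open>\<rho>\<close> and \<open>\<sigma>\<close> are the translation parts of f
    after g and of g after f.\<close>
  define \<rho> where "\<rho> = r1 / s1 + r2 / (b1 * s2)"
  define \<sigma> where "\<sigma> = r2 / s2 + r1 / (b2 * s1)"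
  have step: "\<rho> + c / B \<in> C" "\<sigma> + c / B \<in> C" if "c \<in> C" for c
  proof -
    have "\<rho> + c / B = f (g c)" "\<sigma> + c / B = g (f c)"
      using assms(1-4) by (simp_all add: assms(7,8) B(2) \<rho>_def \<sigma>_def field_simps)
    then show "\<rho> + c / B \<in> C" "\<sigma> + c / B \<in> C" using fC gC that by simp_all
  qed

  \<comment> \<open>N is a common denominator, not necessarily reduced, of \<sigma> - \<rho> and of
    the point \<rho> B/(B - 1) with all digits \<rho>; M and P are the numerators.\<close>
  define N where "N = nat (b1 * b2 * s1 * s2 * (b1 * b2 - 1))"
  define P where "P = b1 * b2 * b2 * (r1 * s2 * b1 + r2 * s1)"
  define M where "M = (b1 * b2 - 1) * (b2 * r2 * s1 * (b1 - 1) - b1 * r1 * s2 * (b2 - 1))"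
  have Bm1: "b1 * b2 - 1 > 0" using \<open>2 * 2 \<le> b1 * b2\<close> by linarith
  then have Npos: "b1 * b2 * s1 * s2 * (b1 * b2 - 1) > 0" using assms(1-4) by (intro mult_pos_pos) auto
  have N: "N \<noteq> 0" "real N = real_of_int (b1 * b2 * s1 * s2 * (b1 * b2 - 1))"
    using Npos by (auto simp: N_def)
  have Bm1r: "real_of_int b1 * real_of_int b2 - 1 > 0" using Bm1 by (simp flip: of_int_mult)
  have P: "\<rho> * B / (real B - 1) = P / N"
  proof -
    have "\<rho> = (r1 * s2 * b1 + r2 * s1) / (b1 * s1 * s2)"
      using assms(1-4) by (simp add: \<rho>_def field_simps)
    then show ?thesis
      using assms(1-4) Bm1r by (simp add: P_def N(2) B(2) ac_simps)
  qed
  have Meq: "\<sigma> - \<rho> = M / N"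
  proof -
    have "\<sigma> - \<rho> = (b2 * r2 * s1 * (b1 - 1) - b1 * r1 * s2 * (b2 - 1)) / (b1 * b2 * s1 * s2)"
      using assms(1-4) by (simp add: \<rho>_def \<sigma>_def field_simps)
    then show ?thesis
      using assms(1-4) Bm1r by (simp add: M_def N(2))
  qed
  \<comment> \<open>The second factor of M is the difference of the fixed points of g and f, cleared
    of denominators.\<close>
  have M: "M \<noteq> 0"
  proof
    assume "M = 0"
    then have "b1 * r1 * ((b2 - 1) * s2) = b2 * r2 * ((b1 - 1) * s1)"
      using Bm1 by (simp add: M_def ac_simps)
    then have "real_of_int (b1 * r1) * real_of_int ((b2 - 1) * s2) =
        real_of_int (b2 * r2) * real_of_int ((b1 - 1) * s1)"
      by (simp only: flip: of_int_mult)
    moreover have "real_of_int ((b1 - 1) * s1) \<noteq> 0" "real_of_int ((b2 - 1) * s2) \<noteq> 0"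
      using assms(1-4) by auto
    ultimately show False using assms(9) frac_eq_eq by blast
  qed

  define m where "m = CARD('m)"
  have m: "m \<ge> 2" using assms(11) by (simp add: m_def)
  \<comment> \<open>k can be the very quantity that B^k has to dominate, since k <= 2^k <=
    B^k.\<close>
  define k where "k = (4 * nat \<bar>M\<bar>) ^ m * N"
  have k: "(4 * \<bar>real_of_int M\<bar>) ^ m * real N \<le> real B ^ k"
  proof -
    have "k \<le> 2 ^ k" by (rule less_imp_le[OF less_exp])
    also have "(2::nat) ^ k \<le> B ^ k" using B by (intro power_mono) auto
    finally have "real k \<le> real B ^ k" by (simp flip: of_nat_power)
    then show ?thesis by (simp add: k_def)
  qed
  obtain idx :: "'m \<Rightarrow> nat" where idx: "bij_betw idx UNIV {..<m}"
    using ex_bij_betw_finite_nat[of "UNIV :: 'm set"] by (auto simp: m_def atLeast0LessThan)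
  \<comment> \<open>The starting value k + 1 secures both \<open>T 0 \<ge> 1\<close> and
    \<open>k \<le> T 0\<close>.\<close>
  define T where "T = lacunary_seq m (k + 1)"
  define \<Xi> where "\<Xi> X = lacunary_vec B (T X) idx P M N k" for X
  have T: "lacunary B m (T X)" for X
    unfolding T_def using B m by (intro lacunary_lacunary_seq) auto
  have point: "lacunary_point B m (T X) idx M N k" for X
    using T[of X] idx M N k
    by (auto simp: lacunary_point_def lacunary_point_axioms_def m_def T_def)
  have good: "\<Xi> X \<in> Di" "\<Xi> X \<notin> Sing" "liouville_vector (\<Xi> X)" for X
    using lacunary_point.\<xi>_Di[OF point] lacunary_point.\<xi>_not_Sing[OF point]
      lacunary_point.\<xi>_liouville[OF point] lacunary_point.\<xi>_def[OF point]
    by (simp_all add: \<Xi>_def)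
  have inK: "\<Xi> X \<in> K" for X
  proof -
    have "\<Xi> X $ i \<in> C" for i
    proof -
      have mono: "strict_mono (\<lambda>n. Suc (idx i) * T X n)"
        by (rule lacunary.mult_T_mono[OF T]) simp
      have "k \<le> Suc (idx i) * T X n" for n
      proof -
        have "k \<le> T X 0" by (simp add: T_def)
        also have "\<dots> \<le> T X n" using strict_mono_less_eq[OF lacunary.T_mono[OF T]] by simp
        also have "\<dots> \<le> Suc (idx i) * T X n" by simp
        finally show ?thesis .
      qed
      from lacunary_in_invariant[OF compact_imp_closed[OF C(2)] C(1) B(1) step mono this]
      show ?thesis by (simp add: \<Xi>_def lacunary_vec_def P Meq add_divide_distrib)
    qed
    then show ?thesis by (simp add: assms(12))
  qed
  have "inj \<Xi>"
  proof
    fix X X'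
    assume "\<Xi> X = \<Xi> X'"
    then have "T X = T X'"
      unfolding \<Xi>_def using lacunary.T_mono[OF T] B(1) M N(1) by (intro lacunary_vec_inject)
    then show "X = X'" using inj_lacunary_seq unfolding T_def by (rule injD[rotated])
  qed
  then have "uncountable (range \<Xi>)"
    using uncountable_nat_sets countable_image_inj_on by blast
  moreover have "range \<Xi> \<subseteq> {\<xi> \<in> K. liouville_vector \<xi> \<and> \<xi> \<in> Di \<and> \<xi> \<notin> Sing}"
    using good inK by blast
  ultimately have "uncountable {\<xi> \<in> K. liouville_vector \<xi> \<and> \<xi> \<in> Di \<and> \<xi> \<notin> Sing}"
    using countable_subset by blast
  moreover have "\<Xi> {} \<in> FS \<inter> K"
    using good inK liouville_not_Bad[OF good(3)] by (simp add: FS_def)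
  ultimately show ?thesis by blast
qed

end
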